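(* Let $D:=mN$, let $\mathcal I^{D}:=[0,T]^{D}\times\mathcal B^{D}$, and let $\overline{x}\in\mathbb R^d$. Suppose that for every $\varepsilon>0$ one has $\overline{x}\in\mathcal X_\varepsilon$, where $\mathcal X_\varepsilon=\{y\in\mathbb R^d : V(y,\varepsilon)<+\infty\}$, and that the strict feasibility condition stated in the context holds for $\overline x$. For $\varepsilon>0$ consider the maximization problem $$\sup_{(\mathfrak t,\mathfrak b)\in\mathcal I^{D}} G(\overline{x},\varepsilon;\mathfrak t,\mathfrak b),$$ and let $(\mathfrak t^{*}(\overline x,\varepsilon),\mathfrak b^{*}(\overline x,\varepsilon))\in\mathcal I^{D}$ be a solution (maximizer) of it. Then: (1) for every $\varepsilon>0$, $$V(\overline{x},\varepsilon)=G\bigl(\overline{x},\varepsilon;\mathfrak t^{*}(\overline x,\varepsilon),\mathfrak b^{*}(\overline x,\varepsilon)\bigr);$$ (2) the family $(\Theta^{*}_{\overline x,\varepsilon})_{\varepsilon>0}$, where $\Theta^{*}_{\overline x,\varepsilon}$ is the minimizer of $\Theta\mapsto J(\Theta)+\varepsilon R(\Theta)$ over all $\Theta\in\mathcal A$ satisfying the constraints of the relaxed problem defining $G(\overline x,\varepsilon;\mathfrak t,\mathfrak b)$ at $(\mathfrak t,\mathfrak b)=(\mathfrak t^{*}(\overline x,\varepsilon),\mathfrak b^{*}(\overline x,\varepsilon))$, converges as $\varepsilon\downarrow 0$ to an optimizer of the unregularized semi-infinite program $$\inf_{\Theta\in\mathcal A}\ J(\Theta)\quad\text{subject to}\quad x(t;\overline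 x,\Theta,\beta)\in\mathbb X,\ x(T;\overline x,\Theta,\beta)\in X_F,\ \Theta\Psi(t)\in\mathbb U\ \text{ for all }(t,\beta)\in[0,T]\times\mathcal B.$$
   Context: System and constraint data. Let $d,m\in\mathbb N$, $T>0$, $A\in\mathbb R^{d\times d}$, $B\in\mathbb R^{d\times m}$, and consider $\dot x(t)=Ax(t)+Bu(t)+w(t)$ for $t\in[0,T]$, $x(0)=\overline x\in\mathbb R^d$. Let $\mathbb U=\prod_{i=1}^m[-\bar u^i,\bar u^i]\subset\mathbb R^m$ with each $\bar u^i>0$, and $\mathbb W=\prod_{j=1}^d[-\bar w^j,\bar w^j]\subset\mathbb R^d$ with each $\bar w^j>0$. Let $\mathbb X\subset\mathbb R^d$ be compact and convex with $0$ in its interior, and let $X_F\subset\mathbb X$ be compact and convex with $0$ in its interior. Piecewise constant functions. Fix $h>0$ and a uniform partition $0=t_0<\cdots<t_K\le T$ with $t_k-t_{k-1}=h$ for $k=1,\dots,K$ and $T-t_K\le h$. $\mathrm{PC}_h([0,T];\mathbb R)$ is the set of functions $y:[0,T]\to\mathbb R$ that are constant on each $[t_{k-1},t_k)$, $k=1,\dots,K$, and constant on $[t_K,T]$. Parametrization. Let $N,M\in\mathbb N$; let $\psi_1,\dots,\psi_N\in\mathrm{PC}_h([0,T];\mathbb R)$ be linearly independent with $\max_i\max_t|\psi_i(t)|=1$, and let $\varphi_1,\dots,\varphi_M\in\mathrm{PC}_h([0,T];\mathbb R)$ be linearly independent with $\max_j\max_t|\varphi_j(t)|=1$. Put $\Psi(t)=(\psi_1(t),\dots,\psi_N(t))^{\top}\in\mathbb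 R^N$ and $\Phi(t)=(\varphi_1(t),\dots,\varphi_M(t))^{\top}\in\mathbb R^M$. Controls are $u(t)=\Theta\Psi(t)$ with $\Theta\in\mathbb R^{m\times N}$, and disturbances are $w(t)=\beta\Phi(t)$ with $\beta\in\mathbb R^{d\times M}$. Admissible parameter sets: $$\mathcal A=\{\Theta\in\mathbb R^{m\times N}:\Theta\Psi(t)\in\mathbb U\ \forall t\in[0,T]\},\qquad \mathcal B=\{\beta\in\mathbb R^{d\times M}:\beta\Phi(t)\in\mathbb W\ \forall t\in[0,T]\}.$$ The state trajectory is $$x(t;\overline x,\Theta,\beta)=e^{At}\overline x+\int_0^t e^{A(t-\tau)}B\Theta\Psi(\tau)\,d\tau+\int_0^t e^{A(t-\tau)}\beta\Phi(\tau)\,d\tau .$$ Objective. With $\Psi_{k-1}$ the value of $\Psi$ on $[t_{k-1},t_k)$ ($k=1,\dots,K$) and $\Psi_K$ its value on $[t_K,T]$, $$J(\Theta)=\int_0^T\|\Theta\Psi(t)\|_{\ell_1}\,dt=\sum_{k=1}^K h\|\Theta\Psi_{k-1}\|_{\ell_1}+(T-t_K)\|\Theta\Psi_K\|_{\ell_1}.$$ $R:\mathbb R^{m\times N}\to\mathbb R$ is a continuous, positive, strictly convex function. Regularized program. $V(\overline x,\varepsilon)$ is the optimal value ($+\infty$ if infeasible) of $$\inf_{\Theta\in\mathcal A}\ J(\Theta)+\varepsilon R(\Theta)\quad\text{s.t. } x(t;\overline x,\Theta,\beta)\in\mathbb X,\ x(T;\overline x,\Theta,\beta)\in X_F,\ \Theta\Psi(t)\in\mathbb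 U\ \ \forall (t,\beta)\in[0,T]\times\mathcal B.$$ Relaxed program. For $\mathfrak t=(t^1,\dots,t^D)\in[0,T]^D$ and $\mathfrak b=(\beta^1,\dots,\beta^D)\in\mathcal B^D$ with $D=mN$, $G(\overline x,\varepsilon;\mathfrak t,\mathfrak b)$ is the optimal value of $$\inf_{\Theta\in\mathcal A}\ J(\Theta)+\varepsilon R(\Theta)\quad\text{s.t. } x(t^i;\overline x,\Theta,\beta^i)\in\mathbb X,\ x(T;\overline x,\Theta,\beta^i)\in X_F,\ \Theta\Psi(t^i)\in\mathbb U,\ \ i=1,\dots,D.$$ Strict feasibility condition. There exist $\Theta$ and a nonempty open set $O\subset\operatorname{int}\mathbb X\times\operatorname{int}\mathbb U$ such that $(x(t;\overline x,\Theta,\beta),\Theta\Psi(t))\in O$ and $x(T;\overline x,\Theta,\beta)\in\operatorname{int}X_F$ for all $\beta\in\mathcal B$ and all $t\in[0,T]$. *)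

theory Defs
  imports "HOL-Analysis.Analysis"
begin

text \<open>Data of the problem. The dimensions \<open>d\<close>, \<open>m\<close> (state, control) and the numbers \<open>N\<close>, \<open>M\<close> of
  control and disturbance basis functions are the cardinalities of \<open>'d\<close>, \<open>'m\<close>, \<open>'n\<close>, \<open>'k\<close>.
  Functions on \<open>[0,T]\<close> are represented by functions on \<open>real\<close> whose values outside \<open>[0,T]\<close>
  are never used.\<close>

record ('d::finite, 'm::finite, 'n::finite, 'k::finite) ocp_data =
  horizon :: real                                   \<comment> \<open>\<open>T\<close>\<close>
  Amat :: "real^'d^'d"
  Bmat :: "real^'m^'d"
  ubar :: "real^'m"
  wbar :: "real^'d"
  stateX :: "(real^'d) set"                         \<comment> \<open>\<open>X\<close>\<close>
  termX :: "(real^'d) set"                          \<comment> \<open>\<open>X\<^sub>F\<close>\<close>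
  step :: real                                      \<comment> \<open>\<open>h\<close>\<close>
  cells :: nat                                      \<comment> \<open>\<open>K\<close>\<close>
  node :: "nat \<Rightarrow> real"                             \<comment> \<open>\<open>t\<^sub>0, \<dots>, t\<^sub>K\<close>\<close>
  psi :: "'n \<Rightarrow> real \<Rightarrow> real"
  phi :: "'k \<Rightarrow> real \<Rightarrow> real"
  reg :: "real^'n^'m \<Rightarrow> real"                       \<comment> \<open>\<open>R\<close>\<close>

definition strictly_convex_on :: "'a::real_vector set \<Rightarrow> ('a \<Rightarrow> real) \<Rightarrow> bool" where
  "strictly_convex_on S f \<longleftrightarrow> convex S \<and>
     (\<forall>x\<in>S. \<forall>y\<in>S. \<forall>s. x \<noteq> y \<longrightarrow> 0 < s \<longrightarrow> s < 1 \<longrightarrow>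
        f ((1 - s) *\<^sub>R x + s *\<^sub>R y) < (1 - s) * f x + s * f y)"

definition piecewise_const :: "real \<Rightarrow> nat \<Rightarrow> (nat \<Rightarrow> real) \<Rightarrow> (real \<Rightarrow> real) set" where
  "piecewise_const T K t =
     {y. (\<forall>k\<in>{1..K}. y constant_on {t (k - 1)..<t k}) \<and> y constant_on {t K..T}}"

definition lin_indep_on :: "'b set \<Rightarrow> ('a::finite \<Rightarrow> 'b \<Rightarrow> real) \<Rightarrow> bool" where
  "lin_indep_on S f \<longleftrightarrow>
     (\<forall>c. (\<forall>t\<in>S. (\<Sum>i\<in>UNIV. c i * f i t) = 0) \<longrightarrow> (\<forall>i. c i = 0))"

locale robust_ocp =
  fixes S :: "('d::finite, 'm::finite, 'n::finite, 'k::finite) ocp_data"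
  assumes horizon_pos: "0 < horizon S"
    and ubar_pos: "\<And>i. 0 < ubar S $ i"
    and wbar_pos: "\<And>j. 0 < wbar S $ j"
    and stateX: "compact (stateX S)" "convex (stateX S)" "0 \<in> interior (stateX S)"
    and termX: "termX S \<subseteq> stateX S" "compact (termX S)" "convex (termX S)"
      "0 \<in> interior (termX S)"
    and step_pos: "0 < step S"
    and node_0: "node S 0 = 0"
    and node_diff: "\<And>k. k \<in> {1..cells S} \<Longrightarrow> node S k - node S (k - 1) = step S"
    and node_last: "node S (cells S) \<le> horizon S" "horizon S - node S (cells S) \<le> step S"
    and psi_pc: "\<And>i. psi S i \<in> piecewise_const (horizon S) (cells S) (node S)"
    and psi_indep: "lin_indep_on {0..horizon S} (psi S)"
    and psi_max: "(MAX i. MAX t\<in>{0..horizon S}. \<bar>psi S i t\<bar>) = 1"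
    and phi_pc: "\<And>j. phi S j \<in> piecewise_const (horizon S) (cells S) (node S)"
    and phi_indep: "lin_indep_on {0..horizon S} (phi S)"
    and phi_max: "(MAX j. MAX t\<in>{0..horizon S}. \<bar>phi S j t\<bar>) = 1"
    and reg_cont: "continuous_on UNIV (reg S)"
    and reg_pos: "\<And>\<Theta>. 0 < reg S \<Theta>"
    and reg_strict: "strictly_convex_on UNIV (reg S)"

definition Psi :: "('d::finite, 'm::finite, 'n::finite, 'k::finite) ocp_data \<Rightarrow> real \<Rightarrow> real^'n" where
  "Psi S t = (\<chi> i. psi S i t)"

definition Phi :: "('d::finite, 'm::finite, 'n::finite, 'k::finite) ocp_data \<Rightarrow> real \<Rightarrow> real^'k" where
  "Phi S t = (\<chi> j. phi S j t)"

definition ctrlU :: "('d::finite, 'm::finite, 'n::finite, 'k::finite) ocp_data \<Rightarrow> (real^'m) set" where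
  "ctrlU S = {u. \<forall>i. u $ i \<in> {- (ubar S $ i)..ubar S $ i}}"

definition distW :: "('d::finite, 'm::finite, 'n::finite, 'k::finite) ocp_data \<Rightarrow> (real^'d) set" where
  "distW S = {w. \<forall>j. w $ j \<in> {- (wbar S $ j)..wbar S $ j}}"

definition admA :: "('d::finite, 'm::finite, 'n::finite, 'k::finite) ocp_data \<Rightarrow> (real^'n^'m) set" where
  "admA S = {\<Theta>. \<forall>t\<in>{0..horizon S}. \<Theta> *v Psi S t \<in> ctrlU S}"

definition admB :: "('d::finite, 'm::finite, 'n::finite, 'k::finite) ocp_data \<Rightarrow> (real^'k^'d) set" where
  "admB S = {\<beta>. \<forall>t\<in>{0..horizon S}. \<beta> *v Phi S t \<in> distW S}"

text \<open>The product \<open>*\<close> on \<open>real^'d^'d\<close> is componentwise, so powers have to be taken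
  with respect to \<open>**\<close>.\<close>

definition mat_exp :: "real^'d^'d \<Rightarrow> real^'d^'d::finite" where
  "mat_exp A = (\<Sum>k. (1 / fact k) *\<^sub>R (((\<lambda>M. A ** M) ^^ k) (mat 1)))"

definition traj ::
  "('d::finite, 'm::finite, 'n::finite, 'k::finite) ocp_data \<Rightarrow>
     real^'d \<Rightarrow> real^'n^'m \<Rightarrow> real^'k^'d \<Rightarrow> real \<Rightarrow> real^'d" where
  "traj S x0 \<Theta> \<beta> t =
     mat_exp (t *\<^sub>R Amat S) *v x0
     + integral {0..t} (\<lambda>\<tau>. mat_exp ((t - \<tau>) *\<^sub>R Amat S) *v (Bmat S *v (\<Theta> *v Psi S \<tau>)))
     + integral {0..t} (\<lambda>\<tau>. mat_exp ((t - \<tau>) *\<^sub>R Amat S) *v (\<beta> *v Phi S \<tau>))"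

definition l1_norm :: "real^'a::finite \<Rightarrow> real" where
  "l1_norm v = (\<Sum>i\<in>UNIV. \<bar>v $ i\<bar>)"

definition costJ ::
  "('d::finite, 'm::finite, 'n::finite, 'k::finite) ocp_data \<Rightarrow> real^'n^'m \<Rightarrow> real" where
  "costJ S \<Theta> = integral {0..horizon S} (\<lambda>t. l1_norm (\<Theta> *v Psi S t))"

definition reg_cost ::
  "('d::finite, 'm::finite, 'n::finite, 'k::finite) ocp_data \<Rightarrow> real \<Rightarrow> real^'n^'m \<Rightarrow> real" where
  "reg_cost S \<epsilon> \<Theta> = costJ S \<Theta> + \<epsilon> * reg S \<Theta>"

definition sip_feasible ::
  "('d::finite, 'm::finite, 'n::finite, 'k::finite) ocp_data \<Rightarrow> real^'d \<Rightarrow> (real^'n^'m) set" where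
  "sip_feasible S x0 =
     {\<Theta> \<in> admA S. \<forall>t\<in>{0..horizon S}. \<forall>\<beta>\<in>admB S.
        traj S x0 \<Theta> \<beta> t \<in> stateX S \<and>
        traj S x0 \<Theta> \<beta> (horizon S) \<in> termX S \<and>
        \<Theta> *v Psi S t \<in> ctrlU S}"

text \<open>Optimal values live in \<open>ereal\<close>; the infimum over an empty feasible set is \<open>\<infinity>\<close>.\<close>

definition valV ::
  "('d::finite, 'm::finite, 'n::finite, 'k::finite) ocp_data \<Rightarrow> real^'d \<Rightarrow> real \<Rightarrow> ereal" where
  "valV S x0 \<epsilon> = (INF \<Theta>\<in>sip_feasible S x0. ereal (reg_cost S \<epsilon> \<Theta>))"

definition feasible_states ::
  "('d::finite, 'm::finite, 'n::finite, 'k::finite) ocp_data \<Rightarrow> real \<Rightarrow> (real^'d) set" where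
  "feasible_states S \<epsilon> = {y. valV S y \<epsilon> < \<infinity>}"

definition dimD :: "('d::finite, 'm::finite, 'n::finite, 'k::finite) ocp_data \<Rightarrow> nat" where
  "dimD S = CARD('m) * CARD('n)"

definition index_tuples ::
  "('d::finite, 'm::finite, 'n::finite, 'k::finite) ocp_data \<Rightarrow>
     ((nat \<Rightarrow> real) \<times> (nat \<Rightarrow> real^'k^'d)) set" where
  "index_tuples S =
     ({1..dimD S} \<rightarrow>\<^sub>E {0..horizon S}) \<times> ({1..dimD S} \<rightarrow>\<^sub>E admB S)"

definition relaxed_feasible ::
  "('d::finite, 'm::finite, 'n::finite, 'k::finite) ocp_data \<Rightarrow> real^'d \<Rightarrow>
     (nat \<Rightarrow> real) \<times> (nat \<Rightarrow> real^'k^'d) \<Rightarrow> (real^'n^'m) set" where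
  "relaxed_feasible S x0 = (\<lambda>(t, b).
     {\<Theta> \<in> admA S. \<forall>i\<in>{1..dimD S}.
        traj S x0 \<Theta> (b i) (t i) \<in> stateX S \<and>
        traj S x0 \<Theta> (b i) (horizon S) \<in> termX S \<and>
        \<Theta> *v Psi S (t i) \<in> ctrlU S})"

definition valG ::
  "('d::finite, 'm::finite, 'n::finite, 'k::finite) ocp_data \<Rightarrow> real^'d \<Rightarrow> real \<Rightarrow>
     (nat \<Rightarrow> real) \<times> (nat \<Rightarrow> real^'k^'d) \<Rightarrow> ereal" where
  "valG S x0 \<epsilon> p = (INF \<Theta>\<in>relaxed_feasible S x0 p. ereal (reg_cost S \<epsilon> \<Theta>))"

definition strictly_feasible ::
  "('d::finite, 'm::finite, 'n::finite, 'k::finite) ocp_data \<Rightarrow> real^'d \<Rightarrow> bool" where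
  "strictly_feasible S x0 \<longleftrightarrow>
     (\<exists>\<Theta> Q. open Q \<and> Q \<noteq> {} \<and> Q \<subseteq> interior (stateX S) \<times> interior (ctrlU S) \<and>
        (\<forall>\<beta>\<in>admB S. \<forall>t\<in>{0..horizon S}.
           (traj S x0 \<Theta> \<beta> t, \<Theta> *v Psi S t) \<in> Q \<and>
           traj S x0 \<Theta> \<beta> (horizon S) \<in> interior (termX S)))"

end

theory Submission
  imports Defs
begin

text \<open>
The semi-infinite program has a decision variable in a space of dimension \<open>D = m N\<close> and, for each
index \<open>(t, \<beta>)\<close>, a compact convex constraint set. Its value is approximated arbitrarily well by
relaxations with only \<open>D\<close> indices, by Helly's theorem: for \<open>v\<close> below the optimal value, the
sublevel set \<open>{J + \<epsilon> R \<le> v}\<close> and the constraint sets have no common point, so by compactness at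
most \<open>D + 1\<close> of these convex sets already have none. The sublevel set must be one of them, since the constraint sets
alone have a common point. That leaves \<open>D\<close> constraints whose relaxed program has value at least \<open>v\<close>
(\<open>Helly_with_distinguished_set\<close>, \<open>ex_tuple_valG_ge\<close>). A relaxation never exceeds the full program,
so a maximizing tuple gives exactly the optimal value (\<open>maximal_relaxation_exact\<close>).

At a maximizing tuple the solution of the full program is feasible for the relaxed one and attains its
value. By strict convexity the relaxed minimizer is therefore the full one. The limit \<open>\<epsilon> \<down> 0\<close> then no
longer involves the tuples: it is Tikhonov regularization over one fixed compact convex set, whose
minimizers converge to the \<open>R\<close>-minimal element among the minimizers of \<open>J\<close>
(\<open>tendsto_regularized_minimizers\<close>).

What has to be known about the control system is that the constraint sets are compact and convex. The
trajectory at a fixed time is affine in \<open>\<Theta>\<close>; this requires integrability of the variation-of-constants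
integrand, hence continuity of the matrix exponential. The admissible matrices are bounded because, by
linear independence of the \<open>\<psi>\<^sub>i\<close>, the values of \<open>\<Psi>\<close> span the whole space.
\<close>

section \<open>Strictly convex minimization and vanishing regularization\<close>

lemma strictly_convex_on_imp_convex_on:
  assumes "strictly_convex_on S f"
  shows "convex_on S f"
proof (rule convex_onI)
  fix s :: real and x y assume "0 < s" "s < 1" "x \<in> S" "y \<in> S"
  then show "f ((1 - s) *\<^sub>R x + s *\<^sub>R y) \<le> (1 - s) * f x + s * f y"
    using assms unfolding strictly_convex_on_def
    by (cases "x = y") (auto simp: left_diff_distrib intro: less_imp_le simp flip: scaleR_add_left)
qed (use assms in \<open>auto simp: strictly_convex_on_def\<close>)

lemma strictly_convex_on_add_scaled:
  assumes J: "convex_on S J" and R: "strictly_convex_on S R" and "0 < (\<epsilon>::real)"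
  shows "strictly_convex_on S (\<lambda>x. J x + \<epsilon> * R x)"
  unfolding strictly_convex_on_def
proof (intro conjI ballI allI impI)
  show "convex S" using R by (simp add: strictly_convex_on_def)
  fix x y s assume *: "x \<in> S" "y \<in> S" "x \<noteq> y" "0 < s" "s < (1::real)"
  then have "R ((1 - s) *\<^sub>R x + s *\<^sub>R y) < (1 - s) * R x + s * R y"
    using R by (simp add: strictly_convex_on_def)
  then have "\<epsilon> * R ((1 - s) *\<^sub>R x + s *\<^sub>R y) < \<epsilon> * ((1 - s) * R x + s * R y)"
    using \<open>0 < \<epsilon>\<close> by simp
  moreover have "J ((1 - s) *\<^sub>R x + s *\<^sub>R y) \<le> (1 - s) * J x + s * J y"
    using convex_onD[OF J, of s x y] * by simp
  ultimately show "J ((1 - s) *\<^sub>R x + s *\<^sub>R y) + \<epsilon> * R ((1 - s) *\<^sub>R x + s *\<^sub>R y)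
      < (1 - s) * (J x + \<epsilon> * R x) + s * (J y + \<epsilon> * R y)"
    by (simp add: algebra_simps)
qed

lemma convex_sublevel:
  assumes "convex_on UNIV f"
  shows "convex {x. f x \<le> (v::real)}"
proof (rule convexI)
  fix x y a b assume *: "x \<in> {x. f x \<le> v}" "y \<in> {x. f x \<le> v}" "0 \<le> a" "0 \<le> b" "a + b = (1::real)"
  then have "f (a *\<^sub>R x + b *\<^sub>R y) \<le> a * f x + b * f y"
    using assms by (auto simp: convex_on_def)
  also have "\<dots> \<le> a * v + b * v"
    using * by (intro add_mono mult_left_mono) auto
  also have "\<dots> = v" using * by (simp flip: distrib_right)
  finally show "a *\<^sub>R x + b *\<^sub>R y \<in> {x. f x \<le> v}" by simp
qed

text \<open>Of two distinct minimizers, the midpoint would be strictly better.\<close>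

lemma ex1_arg_min_strictly_convex:
  assumes K: "compact K" "convex K" "K \<noteq> {}"
    and f: "continuous_on K f" "strictly_convex_on UNIV f"
  shows "\<exists>!x. is_arg_min f (\<lambda>x. x \<in> K) x"
proof -
  obtain x where x: "x \<in> K" "\<And>y. y \<in> K \<Longrightarrow> f x \<le> f y"
    using continuous_attains_inf[OF K(1,3) f(1)] by auto
  show ?thesis
  proof (rule ex1I)
    show "is_arg_min f (\<lambda>x. x \<in> K) x"
      using x by (simp add: is_arg_min_linorder)
  next
    fix y assume "is_arg_min f (\<lambda>x. x \<in> K) y"
    then have y: "y \<in> K" "f y \<le> f x" using x by (auto simp: is_arg_min_linorder)
    let ?z = "(1 - 1/2) *\<^sub>R x + (1/2) *\<^sub>R y"
    have "?z \<in> K" using convexD_alt[OF K(2) x(1) y(1), of "1/2"] by simp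
    then have "f x \<le> f ?z" by (rule x(2))
    moreover have "f ?z < (1 - 1/2) * f x + (1/2) * f y" if "x \<noteq> y"
      using f(2)[unfolded strictly_convex_on_def, THEN conjunct2, rule_format, of x y "1/2"] that
      by simp
    ultimately show "y = x" using y(2) by fastforce
  qed
qed

text \<open>Comparison with the \<open>R\<close>-minimal minimizer \<open>x0\<close> of \<open>J\<close> shows that \<open>R (m \<epsilon>) \<le> R x0\<close> and that
\<open>J (m \<epsilon>)\<close> exceeds \<open>J x0\<close> by at most \<open>\<epsilon> * R x0\<close>. Away from \<open>x0\<close>, on the compact set where
\<open>R \<le> R x0\<close>, uniqueness of \<open>x0\<close> makes \<open>J\<close> exceed its minimum by a fixed gap, so \<open>m \<epsilon>\<close> cannot be
there for small \<open>\<epsilon>\<close>.\<close>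

lemma tendsto_regularized_minimizers:
  fixes J R :: "'a::real_normed_vector \<Rightarrow> real"
  assumes K: "compact K" "convex K" "K \<noteq> {}"
    and J: "continuous_on K J" "convex_on UNIV J"
    and R: "continuous_on K R" "strictly_convex_on UNIV R" "\<And>x. 0 < R x"
    and m: "\<And>\<epsilon>. 0 < \<epsilon> \<Longrightarrow> is_arg_min (\<lambda>x. J x + \<epsilon> * R x) (\<lambda>x. x \<in> K) (m \<epsilon>)"
  shows "\<exists>x0. is_arg_min J (\<lambda>x. x \<in> K) x0 \<and> (m \<longlongrightarrow> x0) (at_right 0)"
proof -
  obtain a where a: "a \<in> K" "\<And>y. y \<in> K \<Longrightarrow> J a \<le> J y"
    using continuous_attains_inf[OF K(1,3) J(1)] by auto
  define K0 where "K0 = K \<inter> {x. J x \<le> J a}"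
  have "K0 = K \<inter> J -` {..J a}" by (auto simp: K0_def)
  moreover have "closed \<dots>"
    using K(1) J(1) by (intro continuous_closed_preimage) (auto intro: compact_imp_closed)
  ultimately have "compact K0"
    using K(1) by (metis compact_Int_closed inf.idem inf_assoc)
  moreover have "convex K0"
    unfolding K0_def by (intro convex_Int K convex_sublevel J)
  moreover have "K0 \<noteq> {}" using a by (auto simp: K0_def)
  moreover have "continuous_on K0 R"
    using R(1) by (rule continuous_on_subset) (auto simp: K0_def)
  ultimately obtain x0 where x0: "is_arg_min R (\<lambda>x. x \<in> K0) x0"
      "\<And>y. is_arg_min R (\<lambda>x. x \<in> K0) y \<Longrightarrow> y = x0"
    using ex1_arg_min_strictly_convex[OF _ _ _ _ R(2)] by metis
  have x0K: "x0 \<in> K" and Jx0: "\<And>y. y \<in> K \<Longrightarrow> J x0 \<le> J y"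
    using x0(1) a(2) by (force simp: is_arg_min_linorder K0_def)+
  have "eventually (\<lambda>\<epsilon>. m \<epsilon> \<in> U) (at_right 0)" if U: "open U" "x0 \<in> U" for U
  proof -
    define C where "C = {x \<in> K - U. R x \<le> R x0}"
    have cKU: "compact (K - U)" using K(1) U(1) by (rule compact_diff)
    have "C = (K - U) \<inter> R -` {..R x0}" by (auto simp: C_def)
    moreover have "closed \<dots>"
      using cKU R(1) by (intro continuous_closed_preimage) (auto intro: continuous_on_subset compact_imp_closed)
    ultimately have "compact C"
      using cKU by (metis compact_Int_closed inf.idem inf_assoc)
    have gap: "J x0 < J x" if "x \<in> C" for x
    proof (rule ccontr)
      assume "\<not> J x0 < J x"
      then have "x \<in> K0" using that Jx0[OF a(1)] by (auto simp: C_def K0_def)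
      then have "is_arg_min R (\<lambda>x. x \<in> K0) x"
        using x0(1) that by (force simp: is_arg_min_linorder C_def)
      then show False using x0(2) U(2) that by (auto simp: C_def)
    qed
    obtain \<delta> where \<delta>: "0 < \<delta>" "\<And>x. x \<in> C \<Longrightarrow> J x0 + \<delta> \<le> J x"
    proof (cases "C = {}")
      case True
      then show ?thesis using that[of 1] by simp
    next
      case False
      have "continuous_on C J" using J(1) by (rule continuous_on_subset) (auto simp: C_def)
      then obtain c where "c \<in> C" "\<And>y. y \<in> C \<Longrightarrow> J c \<le> J y"
        using continuous_attains_inf[OF \<open>compact C\<close> False] by blast
      then show ?thesis using that[of "J c - J x0"] gap by auto
    qed
    have "m \<epsilon> \<in> U" if "0 < \<epsilon>" "\<epsilon> < \<delta> / R x0" for \<epsilon>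
    proof (rule ccontr)
      assume "m \<epsilon> \<notin> U"
      have mK: "m \<epsilon> \<in> K" and le: "J (m \<epsilon>) + \<epsilon> * R (m \<epsilon>) \<le> J x0 + \<epsilon> * R x0"
        using m[OF that(1)] x0K by (auto simp: is_arg_min_linorder)
      have "\<epsilon> * R (m \<epsilon>) \<le> \<epsilon> * R x0" using le Jx0[OF mK] by linarith
      then have "m \<epsilon> \<in> C" using that(1) mK \<open>m \<epsilon> \<notin> U\<close> by (simp add: C_def)
      then have "\<delta> + \<epsilon> * R (m \<epsilon>) \<le> \<epsilon> * R x0" using \<delta>(2) le by force
      moreover have "\<epsilon> * R x0 < \<delta>" using that(2) R(3)[of x0] by (simp add: pos_less_divide_eq)
      moreover have "0 < \<epsilon> * R (m \<epsilon>)" using that(1) R(3) by simp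
      ultimately show False by linarith
    qed
    then show ?thesis
      using \<delta>(1) R(3)[of x0] unfolding eventually_at_right_field
      by (intro exI[of _ "\<delta> / R x0"]) auto
  qed
  then show ?thesis
    using x0K Jx0 by (intro exI[of _ x0]) (auto simp: is_arg_min_linorder tendsto_def)
qed

section \<open>Helly reduction to finitely many constraints\<close>

text \<open>Helly's theorem alone yields \<open>DIM('a) + 1\<close> sets with empty intersection. One index is saved because
\<open>L\<close> must be among them. The set \<open>L\<close> may be unbounded, so compactness is taken from \<open>C i0\<close>.\<close>

lemma Helly_with_distinguished_set:
  fixes C :: "'i \<Rightarrow> 'a::euclidean_space set"
  assumes I: "i0 \<in> I" and C: "\<And>i. i \<in> I \<Longrightarrow> compact (C i)" "\<And>i. i \<in> I \<Longrightarrow> convex (C i)"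
    and L: "closed L" "convex L"
    and ne: "(\<Inter>i\<in>I. C i) \<noteq> {}" and disj: "L \<inter> (\<Inter>i\<in>I. C i) = {}"
  shows "\<exists>p. (\<forall>j\<in>{1..DIM('a)}. p j \<in> I) \<and> L \<inter> (\<Inter>j\<in>{1..DIM('a)}. C (p j)) = {}"
proof (rule ccontr)
  assume "\<not> ?thesis"
  then have H: "L \<inter> (\<Inter>j\<in>{1..DIM('a)}. C (p j)) \<noteq> {}" if "\<And>j. j \<in> {1..DIM('a)} \<Longrightarrow> p j \<in> I" for p
    using that by blast
  have small: "L \<inter> (\<Inter>i\<in>I'. C i) \<noteq> {}" if I': "finite I'" "I' \<subseteq> I" "card I' \<le> DIM('a)" for I'
  proof -
    obtain e where e: "bij_betw e {1..card I'} I'"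
      using I'(1) ex_bij_betw_nat_finite_1 by blast
    \<comment> \<open>A tuple has exactly \<open>DIM('a)\<close> entries; surplus positions are filled with \<open>i0\<close>.\<close>
    define p where "p j = (if j \<le> card I' then e j else i0)" for j
    have "p j \<in> I" if "j \<in> {1..DIM('a)}" for j
      using bij_betwE[OF e] that I'(2) I by (auto simp: p_def)
    from H[of p, OF this] obtain x where x: "x \<in> L" "\<And>j. j \<in> {1..DIM('a)} \<Longrightarrow> x \<in> C (p j)" by blast
    have "x \<in> C i" if "i \<in> I'" for i
    proof -
      obtain j where "j \<in> {1..card I'}" "i = e j" using e \<open>i \<in> I'\<close> unfolding bij_betw_def by blast
      then show ?thesis using x(2)[of j] I'(3) by (simp add: p_def)
    qed
    then show ?thesis using x(1) by auto
  qed
  have fin: "L \<inter> \<Inter>(C ` I') \<noteq> {}" if I': "finite I'" "I' \<subseteq> I" for I'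
  proof -
    define F where "F = insert L (C ` I')"
    have sub: "\<Inter>t \<noteq> {}" if t: "t \<subseteq> F" "card t \<le> DIM('a) + 1" for t
    proof (cases "L \<in> t")
      case False
      then have "(\<Inter>i\<in>I. C i) \<subseteq> \<Inter>t" using t(1) I'(2) by (auto simp: F_def)
      then show ?thesis using ne by auto
    next
      case True
      have ft: "finite t" using t(1) I'(1) by (auto simp: F_def intro: finite_subset)
      have "t - {L} \<subseteq> C ` I'" using t(1) by (auto simp: F_def)
      \<comment> \<open>Indices with equal sets are identified, so that counting indices is counting sets.\<close>
      then obtain I'' where I'': "I'' \<subseteq> I'" "inj_on C I''" "t - {L} = C ` I''"
        by (meson subset_image_inj)
      have "card I'' = card (t - {L})" using I'' by (simp add: card_image)
      also have "\<dots> \<le> DIM('a)" using t(2) True ft by (simp add: card_Diff_singleton)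
      finally have "L \<inter> (\<Inter>i\<in>I''. C i) \<noteq> {}"
        using I' I''(1) by (intro small) (auto intro: finite_subset)
      moreover have "\<Inter>t = L \<inter> \<Inter>(t - {L})" using True by auto
      ultimately show ?thesis using I''(3) by simp
    qed
    have "\<Inter>F \<noteq> {}"
    proof (cases "card F \<le> DIM('a) + 1")
      case True
      then show ?thesis by (intro sub) auto
    next
      case False
      show ?thesis
      proof (rule Helly)
        show "\<forall>s\<in>F. convex s" using L(2) C(2) I'(2) by (auto simp: F_def)
      qed (use False sub in auto)
    qed
    then show ?thesis by (simp add: F_def)
  qed
  have "(C i0 \<inter> L) \<inter> (\<Inter>i\<in>I. C i) \<noteq> {}"
  proof (rule compact_imp_fip_image)
    show "compact (C i0 \<inter> L)" using C(1)[OF I] L(1) by (rule compact_Int_closed)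
    show "closed (C i)" if "i \<in> I" for i using C(1)[OF that] by (rule compact_imp_closed)
    show "(C i0 \<inter> L) \<inter> (\<Inter>i\<in>I'. C i) \<noteq> {}" if "finite I'" "I' \<subseteq> I" for I'
      using fin[of "insert i0 I'"] that I by auto
  qed
  then show False using disj I by auto
qed

section \<open>Continuity of the matrix exponential\<close>

lemma funpow_scaled_matrix:
  fixes A :: "real^'d^'d::finite"
  shows "((\<lambda>M. (s *\<^sub>R A) ** M) ^^ k) (mat 1) = s ^ k *\<^sub>R ((\<lambda>M. A ** M) ^^ k) (mat 1)"
  by (induction k)
    (simp_all add: matrix_matrix_mult_def vec_eq_iff sum_distrib_left mult.assoc mult.left_commute)

text \<open>The exponential series along \<open>s *\<^sub>R A\<close> is a power series in \<open>s\<close> with matrix coefficients, dominated on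
bounded intervals by the scalar exponential series. The norm of matrices used here is the Euclidean one;
the constant \<open>c\<close> in the proof only bounds left multiplication by \<open>A\<close>.\<close>

lemma continuous_on_mat_exp:
  fixes A :: "real^'d^'d::finite"
  shows "continuous_on UNIV (\<lambda>s. mat_exp (s *\<^sub>R A))"
proof -
  define P where "P k = ((\<lambda>M. A ** M) ^^ k) (mat 1)" for k
  define f where "f k s = (s ^ k / fact k) *\<^sub>R P k" for k and s :: real
  have "linear (\<lambda>M :: real^'d^'d. A ** M)"
    by (rule linearI)
      (simp_all add: matrix_matrix_mult_def vec_eq_iff sum.distrib sum_distrib_left distrib_left mult.left_commute)
  then obtain c where c: "0 < c" "\<And>M :: real^'d^'d. norm (A ** M) \<le> c * norm M"
    using linear_bounded_pos by blast
  have P: "norm (P k) \<le> c ^ k * norm (P 0)" for k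
  proof (induction k)
    case (Suc k)
    have "norm (P (Suc k)) \<le> c * norm (P k)" using c(2) by (simp add: P_def)
    also have "\<dots> \<le> c * (c ^ k * norm (P 0))" using Suc c(1) by simp
    finally show ?case by (simp add: mult.assoc)
  qed simp
  have "continuous_on {-r<..<r} (\<lambda>s. \<Sum>k. f k s)" if "0 < r" for r
  proof (rule uniform_limit_theorem)
    show "uniform_limit {-r<..<r} (\<lambda>n s. \<Sum>k<n. f k s) (\<lambda>s. \<Sum>k. f k s) sequentially"
    proof (rule Weierstrass_m_test)
      fix k s assume "s \<in> {-r<..<r}"
      then have "\<bar>s\<bar> ^ k \<le> r ^ k" by (intro power_mono) auto
      then have "\<bar>s\<bar> ^ k / fact k * norm (P k) \<le> r ^ k / fact k * (c ^ k * norm (P 0))"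
        using P c(1) that by (intro mult_mono divide_right_mono) auto
      then show "norm (f k s) \<le> (inverse (fact k) * (r * c) ^ k) * norm (P 0)"
        by (simp add: f_def power_abs power_mult_distrib field_simps)
    next
      show "summable (\<lambda>k. (inverse (fact k) * (r * c) ^ k) * norm (P 0))"
        by (intro summable_mult2 summable_exp)
    qed
  qed (auto simp: f_def intro!: always_eventually continuous_intros)
  then have "isCont (\<lambda>s. \<Sum>k. f k s) s" for s
    by (rule continuous_on_interior[of "{-(\<bar>s\<bar> + 1)<..<\<bar>s\<bar> + 1}"]) auto
  moreover have "mat_exp (s *\<^sub>R A) = (\<Sum>k. f k s)" for s
    unfolding mat_exp_def funpow_scaled_matrix f_def P_def by simp
  ultimately show ?thesis by (simp add: continuous_at_imp_continuous_on)
qed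

section \<open>Piecewise constant signals\<close>

text \<open>On each cell the integrand agrees with a continuous function except at the right endpoint.\<close>

lemma integrable_piecewise_const_scaleR:
  fixes g :: "real \<Rightarrow> 'a::euclidean_space"
  assumes t: "t 0 = 0" "\<And>k. k \<in> {1..K} \<Longrightarrow> t (k - 1) \<le> t k" "t K \<le> T"
    and y: "y \<in> piecewise_const T K t"
    and g: "continuous_on UNIV g"
  shows "(\<lambda>\<tau>. y \<tau> *\<^sub>R g \<tau>) integrable_on {0..T}"
proof -
  have cell: "(\<lambda>\<tau>. y \<tau> *\<^sub>R g \<tau>) integrable_on {a..b}" if ab: "y constant_on {a..<b}" for a b
  proof -
    obtain c where c: "\<forall>\<tau>\<in>{a..<b}. y \<tau> = c" using ab unfolding constant_on_def by blast
    show ?thesis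
    proof (rule integrable_spike_finite[of "{b}"])
      show "(\<lambda>\<tau>. c *\<^sub>R g \<tau>) integrable_on {a..b}"
        by (intro integrable_continuous_real continuous_intros continuous_on_subset[OF g]) auto
    qed (use c in auto)
  qed
  have "0 \<le> t k \<and> (\<lambda>\<tau>. y \<tau> *\<^sub>R g \<tau>) integrable_on {0..t k}" if "k \<le> K" for k
    using that
  proof (induction k)
    case 0
    show ?case using t(1) integrable_on_refl[of "\<lambda>\<tau>. y \<tau> *\<^sub>R g \<tau>" "0::real"] by simp
  next
    case (Suc k)
    have "t k \<le> t (Suc k)" using t(2)[of "Suc k"] Suc.prems by simp
    moreover have "y constant_on {t k..<t (Suc k)}"
      using y Suc.prems by (force simp: piecewise_const_def dest: bspec[of _ _ "Suc k"])
    ultimately show ?case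
      using Suc cell by (auto intro!: Henstock_Kurzweil_Integration.integrable_combine[of 0 "t k" "t (Suc k)"])
  qed
  moreover have "y constant_on {t K..<T}"
    using y by (auto simp: piecewise_const_def intro: constant_on_subset)
  ultimately show ?thesis
    using cell t(3) by (auto intro: Henstock_Kurzweil_Integration.integrable_combine[of 0 "t K" T])
qed

lemma piecewise_const_vec_compose:
  assumes "\<And>i. y i \<in> piecewise_const T K t"
  shows "(\<lambda>\<tau>. F (\<chi> i. y i \<tau>)) \<in> piecewise_const T K t"
proof -
  have "(\<lambda>\<tau>. F (\<chi> i. y i \<tau>)) constant_on A" if "\<And>i. y i constant_on A" for A
  proof -
    have "\<exists>c. \<forall>i. \<forall>\<tau>\<in>A. y i \<tau> = c i"
      using that unfolding constant_on_def by (intro choice allI)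
    then obtain c where "\<And>i \<tau>. \<tau> \<in> A \<Longrightarrow> y i \<tau> = c i" by blast
    then show ?thesis unfolding constant_on_def by (intro exI[of _ "F (\<chi> i. c i)"]) auto
  qed
  then show ?thesis using assms unfolding piecewise_const_def by blast
qed

text \<open>The gauge integral of a function that is not integrable is 0, so additivity depends on integrability.\<close>

lemma linear_integral:
  fixes F :: "'a::real_vector \<Rightarrow> 'b::euclidean_space \<Rightarrow> 'c::banach"
  assumes "\<And>\<tau>. linear (\<lambda>x. F x \<tau>)" "\<And>x. F x integrable_on A"
  shows "linear (\<lambda>x. integral A (F x))"
proof (rule linearI)
  fix x y r
  have "F (x + y) = (\<lambda>\<tau>. F x \<tau> + F y \<tau>)" "F (r *\<^sub>R x) = (\<lambda>\<tau>. r *\<^sub>R F x \<tau>)"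
    using linear_add[OF assms(1)] linear_scale[OF assms(1)] by auto
  then show "integral A (F (x + y)) = integral A (F x) + integral A (F y)"
      "integral A (F (r *\<^sub>R x)) = r *\<^sub>R integral A (F x)"
    using assms(2) by (simp_all add: integral_add)
qed

text \<open>The vectors on which all these matrices are uniformly bounded form a subspace containing \<open>V\<close>, so
they include the standard basis vectors. That bounds the columns.\<close>

lemma compact_matrices_bounded_on_spanning_set:
  fixes W :: "(real^'m::finite) set" and V :: "(real^'n::finite) set"
  assumes "compact W" "span V = UNIV"
  shows "compact {\<Theta> :: real^'n^'m. \<forall>v\<in>V. \<Theta> *v v \<in> W}" (is "compact ?A")
proof -
  have lin: "linear (\<lambda>\<Theta> :: real^'n^'m. \<Theta> *v v)" for v
    by (rule linearI) (simp_all add: matrix_vector_mult_add_rdistrib scaleR_matrix_vector_assoc)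
  have "?A = (\<Inter>v\<in>V. (\<lambda>\<Theta>. \<Theta> *v v) -` W)" by auto
  also have "closed \<dots>"
    using assms(1) lin
    by (intro closed_INT ballI continuous_closed_vimage) (auto simp: compact_imp_closed linear_continuous_at linear_linear)
  finally have "closed ?A" .
  moreover have "bounded ?A"
  proof -
    define B where "B v \<longleftrightarrow> (\<exists>b. \<forall>\<Theta>\<in>?A. norm (\<Theta> *v v) \<le> b)" for v
    have "B v" for v
    proof (rule span_induct[of v V])
      show "v \<in> span V" using assms(2) by simp
      show "subspace (Collect B)"
      proof (rule subspaceI; clarsimp)
        show "B 0" by (auto simp: B_def)
        show "B (x + y)" if Bxy: "B x" "B y" for x y
        proof -
          obtain b b' where "\<forall>\<Theta>\<in>?A. norm (\<Theta> *v x) \<le> b" "\<forall>\<Theta>\<in>?A. norm (\<Theta> *v y) \<le> b'"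
            using Bxy unfolding B_def by blast
          then have "\<forall>\<Theta>\<in>?A. norm (\<Theta> *v (x + y)) \<le> b + b'"
            unfolding matrix_vector_right_distrib by (blast intro: norm_triangle_le add_mono)
          then show ?thesis unfolding B_def by blast
        qed
        show "B (c *\<^sub>R x)" if Bx: "B x" for c x
        proof -
          obtain b where "\<forall>\<Theta>\<in>?A. norm (\<Theta> *v x) \<le> b" using Bx unfolding B_def by blast
          then have "\<forall>\<Theta>\<in>?A. norm (\<Theta> *v (c *\<^sub>R x)) \<le> \<bar>c\<bar> * b"
            by (simp add: matrix_vector_mult_scaleR mult_left_mono)
          then show ?thesis unfolding B_def by blast
        qed
      qed
      show "B x" if "x \<in> V" for x
      proof -
        obtain b where "\<forall>w\<in>W. norm w \<le> b"
          using compact_imp_bounded[OF assms(1)] unfolding bounded_iff by blast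
        then have "\<forall>\<Theta>\<in>?A. norm (\<Theta> *v x) \<le> b" using that by blast
        then show ?thesis unfolding B_def by blast
      qed
    qed
    then have "\<forall>j. \<exists>b. \<forall>\<Theta>\<in>?A. norm (\<Theta> *v axis j 1) \<le> b"
      unfolding B_def by blast
    from choice[OF this] obtain b where b: "\<And>j \<Theta>. \<Theta> \<in> ?A \<Longrightarrow> norm (\<Theta> *v axis j 1) \<le> b j"
      by blast
    have "norm \<Theta> \<le> (\<Sum>i\<in>(UNIV::'m set). \<Sum>j\<in>UNIV. b j)" if "\<Theta> \<in> ?A" for \<Theta>
    proof -
      have "\<bar>\<Theta> $ i $ j\<bar> \<le> b j" for i j
        using b[OF that, of j] component_le_norm_cart[of "column j \<Theta>" i]
        by (simp add: matrix_vector_mult_basis column_def)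
      then have row: "norm (\<Theta> $ i) \<le> (\<Sum>j\<in>UNIV. b j)" for i
        by (intro order_trans[OF norm_le_l1_cart] sum_mono)
      have "norm \<Theta> \<le> (\<Sum>i\<in>UNIV. norm (\<Theta> $ i))"
        unfolding norm_vec_def[of \<Theta>] by (rule L2_set_le_sum) simp
      also have "\<dots> \<le> (\<Sum>i\<in>(UNIV::'m set). \<Sum>j\<in>UNIV. b j)" by (intro sum_mono row)
      finally show ?thesis .
    qed
    then show ?thesis by (auto simp: bounded_iff)
  qed
  ultimately show ?thesis by (simp add: compact_eq_bounded_closed)
qed

section \<open>Feasible sets and cost of the control problem\<close>

lemma l1_norm_convex_combination:
  assumes "0 \<le> a" "0 \<le> b"
  shows "l1_norm (a *\<^sub>R v + b *\<^sub>R w) \<le> a * l1_norm v + b * l1_norm w"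
proof -
  have "\<bar>a * v $ i + b * w $ i\<bar> \<le> a * \<bar>v $ i\<bar> + b * \<bar>w $ i\<bar>" for i
    using abs_triangle_ineq[of "a * v $ i" "b * w $ i"] assms by (simp add: abs_mult)
  then show ?thesis
    unfolding l1_norm_def by (simp add: sum_distrib_left sum_mono flip: sum.distrib)
qed

text \<open>The conditions attached to one index \<open>(t, \<beta>)\<close>. Admissibility is included in each of them so that
every constraint set is compact on its own.\<close>

definition constraint_set ::
  "('d::finite, 'm::finite, 'n::finite, 'k::finite) ocp_data \<Rightarrow> real^'d \<Rightarrow>
     real \<times> (real^'k^'d) \<Rightarrow> (real^'n^'m) set" where
  "constraint_set S x0 = (\<lambda>(t, \<beta>).
     {\<Theta> \<in> admA S. traj S x0 \<Theta> \<beta> t \<in> stateX S \<and>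
        traj S x0 \<Theta> \<beta> (horizon S) \<in> termX S \<and> \<Theta> *v Psi S t \<in> ctrlU S})"

lemma ctrlU_eq_cbox: "ctrlU S = cbox (- ubar S) (ubar S)"
  by (auto simp: ctrlU_def mem_box_cart)

context robust_ocp
begin

lemma node_mono: "k \<in> {1..cells S} \<Longrightarrow> node S (k - 1) \<le> node S k"
  using node_diff[of k] step_pos by simp

lemmas integrable_signal =
  integrable_piecewise_const_scaleR[OF node_0 node_mono node_last(1)]

lemma integrable_of_Psi: "(\<lambda>\<tau>. F (Psi S \<tau>) :: real) integrable_on {0..horizon S}"
  using integrable_signal[OF _ piecewise_const_vec_compose[OF psi_pc, of F], of "\<lambda>_. 1 :: real"]
  by (simp add: Psi_def)

text \<open>A vector orthogonal to all values of \<open>\<Psi>\<close> holds the coefficients of a vanishing linear combination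
of the \<open>\<psi>\<^sub>i\<close>.\<close>

lemma span_Psi: "span (Psi S ` {0..horizon S}) = UNIV"
proof (rule ccontr)
  assume "span (Psi S ` {0..horizon S}) \<noteq> UNIV"
  then obtain a where a: "a \<noteq> 0" "\<forall>x\<in>span (Psi S ` {0..horizon S}). a \<bullet> x = 0"
    using span_not_UNIV_orthogonal by blast
  have "(\<Sum>i\<in>UNIV. a $ i * psi S i t) = 0" if "t \<in> {0..horizon S}" for t
  proof -
    have "a \<bullet> Psi S t = 0" using a(2) that by (simp add: span_base)
    then show ?thesis by (simp add: inner_vec_def Psi_def)
  qed
  then have "\<forall>i. a $ i = 0"
    using psi_indep unfolding lin_indep_on_def by (elim allE[of _ "\<lambda>i. a $ i"]) simp
  then show False using a(1) by (simp add: vec_eq_iff)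
qed

lemma compact_admA: "compact (admA S)"
proof -
  have "admA S = {\<Theta>. \<forall>v\<in>Psi S ` {0..horizon S}. \<Theta> *v v \<in> ctrlU S}"
    by (auto simp: admA_def)
  then show ?thesis
    using compact_matrices_bounded_on_spanning_set[OF _ span_Psi, of "ctrlU S"]
    by (simp add: ctrlU_eq_cbox)
qed

lemma convex_admA: "convex (admA S)"
proof (rule convexI)
  fix \<Theta> \<Theta>' :: "real^'n^'m" and a b :: real
  assume *: "\<Theta> \<in> admA S" "\<Theta>' \<in> admA S" "0 \<le> a" "0 \<le> b" "a + b = 1"
  have "convex (ctrlU S)" by (simp add: ctrlU_eq_cbox)
  then have "a *\<^sub>R (\<Theta> *v Psi S t) + b *\<^sub>R (\<Theta>' *v Psi S t) \<in> ctrlU S" if "t \<in> {0..horizon S}" for t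
    using * that by (intro convexD) (auto simp: admA_def)
  then show "a *\<^sub>R \<Theta> + b *\<^sub>R \<Theta>' \<in> admA S"
    by (simp add: admA_def matrix_vector_mult_add_rdistrib scaleR_matrix_vector_assoc)
qed

text \<open>In the basis \<open>\<psi>\<^sub>i\<close> the integrand is a sum of piecewise constant scalars times continuous vector
functions, hence integrable.\<close>

lemma linear_control_response:
  assumes t: "t \<in> {0..horizon S}"
  shows "linear (\<lambda>\<Theta>. integral {0..t}
    (\<lambda>\<tau>. mat_exp ((t - \<tau>) *\<^sub>R Amat S) *v (Bmat S *v (\<Theta> *v Psi S \<tau>))))"
proof (rule linear_integral)
  show "linear (\<lambda>\<Theta>. mat_exp ((t - \<tau>) *\<^sub>R Amat S) *v (Bmat S *v (\<Theta> *v Psi S \<tau>)))" for \<tau>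
    by (rule linearI)
      (simp_all add: matrix_vector_mult_add_rdistrib matrix_vector_right_distrib matrix_vector_mult_scaleR
        flip: scaleR_matrix_vector_assoc)
next
  fix \<Theta> :: "real^'n^'m"
  let ?E = "\<lambda>\<tau>. mat_exp ((t - \<tau>) *\<^sub>R Amat S)"
  have Psi: "\<Theta> *v Psi S \<tau> = (\<Sum>i\<in>UNIV. psi S i \<tau> *\<^sub>R column i \<Theta>)" for \<tau>
    by (simp add: matrix_mult_sum Psi_def scalar_mult_eq_scaleR)
  have "continuous_on UNIV (\<lambda>\<tau>. ?E \<tau>)"
    by (rule continuous_on_compose2[OF continuous_on_mat_exp]) (auto intro!: continuous_intros)
  moreover have "linear (\<lambda>M :: real^'d^'d. M *v v)" for v
    by (rule linearI) (simp_all add: matrix_vector_mult_add_rdistrib scaleR_matrix_vector_assoc)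
  ultimately have "continuous_on UNIV (\<lambda>\<tau>. ?E \<tau> *v v)" for v
    by (rule linear_continuous_on_compose)
  then have "(\<lambda>\<tau>. \<Sum>i\<in>UNIV. psi S i \<tau> *\<^sub>R (?E \<tau> *v (Bmat S *v column i \<Theta>)))
      integrable_on {0..horizon S}"
    by (intro integrable_sum integrable_signal psi_pc) auto
  then have "(\<lambda>\<tau>. ?E \<tau> *v (Bmat S *v (\<Theta> *v Psi S \<tau>))) integrable_on {0..horizon S}"
    by (simp add: Psi linear_sum[OF matrix_vector_mul_linear] matrix_vector_mult_scaleR)
  then show "(\<lambda>\<tau>. ?E \<tau> *v (Bmat S *v (\<Theta> *v Psi S \<tau>))) integrable_on {0..t}"
    by (rule integrable_on_subinterval) (use t in auto)
qed

text \<open>With the disturbance fixed, the trajectory at time \<open>t\<close> is the response to zero control plus a linear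
function of \<open>\<Theta>\<close>.\<close>

lemma closed_convex_traj_vimage:
  assumes t: "t \<in> {0..horizon S}" and Y: "closed Y" "convex Y"
  shows "closed {\<Theta>. traj S x0 \<Theta> \<beta> t \<in> Y}" "convex {\<Theta>. traj S x0 \<Theta> \<beta> t \<in> Y}"
proof -
  define L where "L \<Theta> = integral {0..t}
    (\<lambda>\<tau>. mat_exp ((t - \<tau>) *\<^sub>R Amat S) *v (Bmat S *v (\<Theta> *v Psi S \<tau>)))" for \<Theta>
  define c where "c = traj S x0 0 \<beta> t"
  have L: "linear L" unfolding L_def by (rule linear_control_response[OF t])
  have "traj S x0 \<Theta> \<beta> t = c + L \<Theta>" for \<Theta>
    by (simp add: c_def L_def traj_def)
  then have eq: "{\<Theta>. traj S x0 \<Theta> \<beta> t \<in> Y} = L -` ((\<lambda>y. y - c) ` Y)"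
    by (force simp: image_iff algebra_simps)
  show "closed {\<Theta>. traj S x0 \<Theta> \<beta> t \<in> Y}"
    unfolding eq using Y(1) L
    by (intro continuous_closed_vimage closed_translation_subtract) (auto simp: linear_continuous_at linear_linear)
  show "convex {\<Theta>. traj S x0 \<Theta> \<beta> t \<in> Y}"
    unfolding eq using Y(2) L by (intro convex_linear_vimage convex_translation_subtract)
qed

lemma constraint_set_eq:
  assumes "t \<in> {0..horizon S}"
  shows "constraint_set S x0 (t, \<beta>) = admA S \<inter> ({\<Theta>. traj S x0 \<Theta> \<beta> t \<in> stateX S} \<inter>
    {\<Theta>. traj S x0 \<Theta> \<beta> (horizon S) \<in> termX S})"
  using assms by (auto simp: constraint_set_def admA_def)

lemma compact_convex_constraint_set:
  assumes "i \<in> {0..horizon S} \<times> admB S"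
  shows "compact (constraint_set S x0 i)" "convex (constraint_set S x0 i)"
proof -
  obtain t \<beta> where i: "i = (t, \<beta>)" "t \<in> {0..horizon S}" using assms by auto
  have T: "horizon S \<in> {0..horizon S}" using horizon_pos by simp
  show "compact (constraint_set S x0 i)"
    unfolding i(1) constraint_set_eq[OF i(2)]
    by (intro compact_Int_closed compact_admA closed_Int closed_convex_traj_vimage i(2) T
        compact_imp_closed stateX termX)
  show "convex (constraint_set S x0 i)"
    unfolding i(1) constraint_set_eq[OF i(2)]
    by (intro convex_Int convex_admA closed_convex_traj_vimage i(2) T compact_imp_closed stateX termX)
qed

text \<open>Without any index, the intersection over all indices would be the whole space instead of a subset of
\<open>admA S\<close>.\<close>

lemma index_set_nonempty: "(0, 0) \<in> {0..horizon S} \<times> admB S"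
  using horizon_pos wbar_pos by (auto simp: admB_def distW_def intro: less_imp_le)

lemma sip_feasible_eq: "sip_feasible S x0 = (\<Inter>i\<in>{0..horizon S} \<times> admB S. constraint_set S x0 i)"
  using index_set_nonempty by (fastforce simp: sip_feasible_def constraint_set_def)

lemma dimD_eq_DIM: "dimD S = DIM(real^'n^'m)"
  by (simp add: dimD_def)

lemma relaxed_feasible_eq:
  "relaxed_feasible S x0 (t, b) = (\<Inter>j\<in>{1..dimD S}. constraint_set S x0 (t j, b j))"
proof -
  have "1 \<in> {1..dimD S}" unfolding dimD_eq_DIM using DIM_positive[where 'a = "real^'n^'m"] by simp
  then show ?thesis by (fastforce simp: relaxed_feasible_def constraint_set_def)
qed

lemma index_tuples_component:
  assumes "(t, b) \<in> index_tuples S" "j \<in> {1..dimD S}"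
  shows "(t j, b j) \<in> {0..horizon S} \<times> admB S"
  using assms unfolding index_tuples_def by blast

lemma sip_feasible_subset_relaxed:
  assumes "(t, b) \<in> index_tuples S"
  shows "sip_feasible S x0 \<subseteq> relaxed_feasible S x0 (t, b)"
  unfolding sip_feasible_eq relaxed_feasible_eq
  using index_tuples_component[OF assms] by (intro INT_greatest INT_lower)

lemma compact_convex_sip_feasible:
  "compact (sip_feasible S x0)" "convex (sip_feasible S x0)"
proof -
  show "compact (sip_feasible S x0)"
    unfolding sip_feasible_eq using index_set_nonempty compact_convex_constraint_set(1)
    by (intro compact_Inter) blast+
  show "convex (sip_feasible S x0)"
    unfolding sip_feasible_eq by (intro convex_INT compact_convex_constraint_set(2))
qed

lemma compact_convex_relaxed_feasible:
  assumes tb: "(t, b) \<in> index_tuples S"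
  shows "compact (relaxed_feasible S x0 (t, b))" "convex (relaxed_feasible S x0 (t, b))"
proof -
  have "{1..dimD S} \<noteq> {}" unfolding dimD_eq_DIM using DIM_positive[where 'a = "real^'n^'m"] by simp
  then show "compact (relaxed_feasible S x0 (t, b))"
    unfolding relaxed_feasible_eq
    using index_tuples_component[OF tb] compact_convex_constraint_set(1)
    by (intro compact_Inter) blast+
  show "convex (relaxed_feasible S x0 (t, b))"
    unfolding relaxed_feasible_eq
    by (intro convex_INT compact_convex_constraint_set(2) index_tuples_component[OF tb])
qed

lemma convex_costJ: "convex_on UNIV (costJ S)"
  unfolding convex_on_def
proof (intro conjI ballI allI impI)
  fix \<Theta> \<Theta>' :: "real^'n^'m" and a b :: real assume ab: "0 \<le> a" "0 \<le> b"
  note int = integrable_of_Psi[of "\<lambda>v. l1_norm (\<Theta> *v v)" for \<Theta>]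
  have "costJ S (a *\<^sub>R \<Theta> + b *\<^sub>R \<Theta>') \<le>
      integral {0..horizon S} (\<lambda>t. a * l1_norm (\<Theta> *v Psi S t) + b * l1_norm (\<Theta>' *v Psi S t))"
    unfolding costJ_def
  proof (rule integral_le)
    show "(\<lambda>t. a * l1_norm (\<Theta> *v Psi S t) + b * l1_norm (\<Theta>' *v Psi S t)) integrable_on {0..horizon S}"
      by (intro integrable_add integrable_on_mult_right int)
    show "l1_norm ((a *\<^sub>R \<Theta> + b *\<^sub>R \<Theta>') *v Psi S t)
        \<le> a * l1_norm (\<Theta> *v Psi S t) + b * l1_norm (\<Theta>' *v Psi S t)" for t
      using l1_norm_convex_combination[OF ab, of "\<Theta> *v Psi S t" "\<Theta>' *v Psi S t"]
      by (simp add: matrix_vector_mult_add_rdistrib scaleR_matrix_vector_assoc)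
  qed (rule int)
  also have "\<dots> = a * costJ S \<Theta> + b * costJ S \<Theta>'"
    unfolding costJ_def by (subst integral_add) (auto intro!: integrable_on_mult_right int)
  finally show "costJ S (a *\<^sub>R \<Theta> + b *\<^sub>R \<Theta>') \<le> a * costJ S \<Theta> + b * costJ S \<Theta>'" .
qed simp

lemma continuous_on_costJ: "continuous_on A (costJ S)"
  using convex_on_continuous[OF open_UNIV convex_costJ] by (rule continuous_on_subset) simp

lemma strictly_convex_reg_cost: "0 < \<epsilon> \<Longrightarrow> strictly_convex_on UNIV (reg_cost S \<epsilon>)"
  unfolding reg_cost_def by (intro strictly_convex_on_add_scaled convex_costJ reg_strict)

lemma continuous_on_reg_cost: "continuous_on A (reg_cost S \<epsilon>)"
  unfolding reg_cost_def
  by (intro continuous_intros continuous_on_costJ continuous_on_subset[OF reg_cont]) simp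

section \<open>Exactness of the relaxation\<close>

text \<open>The distinguished set in Helly's theorem is the sublevel set of the cost at level \<open>v\<close>; a tuple whose
constraints miss it has relaxed value at least \<open>v\<close>.\<close>

lemma ex_tuple_valG_ge:
  assumes \<epsilon>: "0 < \<epsilon>" and ne: "sip_feasible S x0 \<noteq> {}"
    and v: "\<And>\<Theta>. \<Theta> \<in> sip_feasible S x0 \<Longrightarrow> v < reg_cost S \<epsilon> \<Theta>"
  shows "\<exists>p\<in>index_tuples S. ereal v \<le> valG S x0 \<epsilon> p"
proof -
  let ?I = "{0..horizon S} \<times> admB S" and ?L = "{\<Theta>. reg_cost S \<epsilon> \<Theta> \<le> v}"
  have "closed ?L"
    by (intro closed_Collect_le continuous_on_reg_cost continuous_intros)
  moreover have "convex ?L"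
    by (intro convex_sublevel strictly_convex_on_imp_convex_on strictly_convex_reg_cost \<epsilon>)
  moreover have "?L \<inter> (\<Inter>i\<in>?I. constraint_set S x0 i) = {}"
    using v unfolding sip_feasible_eq[symmetric] by fastforce
  ultimately obtain p where p: "\<forall>j\<in>{1..DIM(real^'n^'m)}. p j \<in> ?I"
      "?L \<inter> (\<Inter>j\<in>{1..DIM(real^'n^'m)}. constraint_set S x0 (p j)) = {}"
    using Helly_with_distinguished_set[of "(0, 0)" ?I "constraint_set S x0" ?L,
        OF index_set_nonempty compact_convex_constraint_set]
      ne[unfolded sip_feasible_eq] by blast
  define t b where "t = restrict (fst \<circ> p) {1..dimD S}" and "b = restrict (snd \<circ> p) {1..dimD S}"
  have "(t, b) \<in> index_tuples S"
    using p(1) unfolding dimD_eq_DIM[symmetric] by (force simp: index_tuples_def t_def b_def)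
  moreover have "relaxed_feasible S x0 (t, b) = (\<Inter>j\<in>{1..dimD S}. constraint_set S x0 (p j))"
    unfolding relaxed_feasible_eq by (intro INF_cong) (auto simp: t_def b_def)
  then have "?L \<inter> relaxed_feasible S x0 (t, b) = {}"
    using p(2) unfolding dimD_eq_DIM by simp
  then have "v \<le> reg_cost S \<epsilon> \<Theta>" if "\<Theta> \<in> relaxed_feasible S x0 (t, b)" for \<Theta>
    using that unfolding disjoint_iff by (meson linear mem_Collect_eq)
  then have "ereal v \<le> valG S x0 \<epsilon> (t, b)"
    unfolding valG_def by (intro INF_greatest) simp
  ultimately show ?thesis by blast
qed

text \<open>The maximal relaxed value lies between every \<open>v\<close> below the optimal value and the optimal value
itself. Once the values agree, a solution of the full program is also optimal in the larger feasible
set of the relaxation.\<close>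

lemma maximal_relaxation_exact:
  assumes \<epsilon>: "0 < \<epsilon>" and ne: "sip_feasible S x0 \<noteq> {}"
    and max: "is_arg_max (valG S x0 \<epsilon>) (\<lambda>p. p \<in> index_tuples S) (t, b)"
    and min: "is_arg_min (reg_cost S \<epsilon>) (\<lambda>\<Theta>. \<Theta> \<in> sip_feasible S x0) \<Theta>s"
  shows "valV S x0 \<epsilon> = valG S x0 \<epsilon> (t, b)"
    and "is_arg_min (reg_cost S \<epsilon>) (\<lambda>\<Theta>. \<Theta> \<in> relaxed_feasible S x0 (t, b)) \<Theta>s"
proof -
  have tb: "(t, b) \<in> index_tuples S" and ub: "\<And>p. p \<in> index_tuples S \<Longrightarrow> valG S x0 \<epsilon> p \<le> valG S x0 \<epsilon> (t, b)"
    using max by (auto simp: is_arg_max_linorder)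
  have \<Theta>s: "\<Theta>s \<in> sip_feasible S x0" "\<And>\<Theta>. \<Theta> \<in> sip_feasible S x0 \<Longrightarrow> reg_cost S \<epsilon> \<Theta>s \<le> reg_cost S \<epsilon> \<Theta>"
    using min by (auto simp: is_arg_min_linorder)
  have V: "valV S x0 \<epsilon> = ereal (reg_cost S \<epsilon> \<Theta>s)"
    unfolding valV_def using \<Theta>s by (intro antisym INF_lower INF_greatest) auto
  show eq: "valV S x0 \<epsilon> = valG S x0 \<epsilon> (t, b)"
  proof (rule antisym)
    show "valG S x0 \<epsilon> (t, b) \<le> valV S x0 \<epsilon>"
      unfolding valG_def valV_def by (intro INF_superset_mono sip_feasible_subset_relaxed tb) simp
    show "valV S x0 \<epsilon> \<le> valG S x0 \<epsilon> (t, b)"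
    proof (rule ccontr)
      assume "\<not> ?thesis"
      then obtain v where v: "valG S x0 \<epsilon> (t, b) < ereal v" "v < reg_cost S \<epsilon> \<Theta>s"
        using ereal_dense2[of "valG S x0 \<epsilon> (t, b)" "valV S x0 \<epsilon>"] by (auto simp: V not_le)
      then obtain p where "p \<in> index_tuples S" "ereal v \<le> valG S x0 \<epsilon> p"
        using ex_tuple_valG_ge[OF \<epsilon> ne, of v] \<Theta>s(2) by (meson less_le_trans)
      then show False using ub v(1) by (meson leD order_trans)
    qed
  qed
  have "reg_cost S \<epsilon> \<Theta>s \<le> reg_cost S \<epsilon> \<Theta>" if "\<Theta> \<in> relaxed_feasible S x0 (t, b)" for \<Theta>
  proof -
    have "ereal (reg_cost S \<epsilon> \<Theta>s) \<le> ereal (reg_cost S \<epsilon> \<Theta>)"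
      unfolding V[symmetric] eq valG_def using that by (rule INF_lower)
    then show ?thesis by simp
  qed
  then show "is_arg_min (reg_cost S \<epsilon>) (\<lambda>\<Theta>. \<Theta> \<in> relaxed_feasible S x0 (t, b)) \<Theta>s"
    using sip_feasible_subset_relaxed[OF tb] \<Theta>s(1) by (auto simp: is_arg_min_linorder)
qed

end

theorem mainTheorem1:
  fixes S :: "('d::finite, 'm::finite, 'n::finite, 'k::finite) ocp_data"
    and xbar :: "real^'d"
    and tstar :: "real \<Rightarrow> nat \<Rightarrow> real"
    and bstar :: "real \<Rightarrow> nat \<Rightarrow> real^'k^'d"
  assumes "robust_ocp S"
    and "\<forall>\<epsilon>>0. xbar \<in> feasible_states S \<epsilon>"
    and "strictly_feasible S xbar"
    and "\<forall>\<epsilon>>0. is_arg_max (valG S xbar \<epsilon>) (\<lambda>p. p \<in> index_tuples S) (tstar \<epsilon>, bstar \<epsilon>)"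
  shows "(\<forall>\<epsilon>>0. valV S xbar \<epsilon> = valG S xbar \<epsilon> (tstar \<epsilon>, bstar \<epsilon>)) \<and>
    (\<forall>\<epsilon>>0. \<exists>!\<Theta>. is_arg_min (reg_cost S \<epsilon>)
        (\<lambda>\<Theta>. \<Theta> \<in> relaxed_feasible S xbar (tstar \<epsilon>, bstar \<epsilon>)) \<Theta>) \<and>
    (\<exists>\<Theta>opt. is_arg_min (costJ S) (\<lambda>\<Theta>. \<Theta> \<in> sip_feasible S xbar) \<Theta>opt \<and>
      ((\<lambda>\<epsilon>. THE \<Theta>. is_arg_min (reg_cost S \<epsilon>)
          (\<lambda>\<Theta>. \<Theta> \<in> relaxed_feasible S xbar (tstar \<epsilon>, bstar \<epsilon>)) \<Theta>) \<longlongrightarrow> \<Theta>opt) (at_right 0))"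
proof -
  interpret robust_ocp S by fact
  let ?K = "sip_feasible S xbar" and ?F = "\<lambda>\<epsilon>. relaxed_feasible S xbar (tstar \<epsilon>, bstar \<epsilon>)"
  let ?m = "\<lambda>\<epsilon>. THE \<Theta>. is_arg_min (reg_cost S \<epsilon>) (\<lambda>\<Theta>. \<Theta> \<in> ?F \<epsilon>) \<Theta>"
  have "valV S xbar 1 < \<infinity>" using assms(2) by (simp add: feasible_states_def)
  then have ne: "?K \<noteq> {}" by (auto simp: valV_def top_ereal_def)
  have max: "is_arg_max (valG S xbar \<epsilon>) (\<lambda>p. p \<in> index_tuples S) (tstar \<epsilon>, bstar \<epsilon>)" if "0 < \<epsilon>" for \<epsilon>
    using assms(4) that by blast
  have tup: "(tstar \<epsilon>, bstar \<epsilon>) \<in> index_tuples S" if "0 < \<epsilon>" for \<epsilon>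
    using max[OF that] by (simp add: is_arg_max_def)
  have min: "\<exists>\<Theta>. is_arg_min (reg_cost S \<epsilon>) (\<lambda>\<Theta>. \<Theta> \<in> ?K) \<Theta>" if "0 < \<epsilon>" for \<epsilon>
    using ex1_arg_min_strictly_convex[OF compact_convex_sip_feasible ne continuous_on_reg_cost
        strictly_convex_reg_cost[OF that]] by blast
  have V: "valV S xbar \<epsilon> = valG S xbar \<epsilon> (tstar \<epsilon>, bstar \<epsilon>)" if "0 < \<epsilon>" for \<epsilon>
    using min[OF that] maximal_relaxation_exact(1)[OF that ne max[OF that]] by blast
  have ex1: "\<exists>!\<Theta>. is_arg_min (reg_cost S \<epsilon>) (\<lambda>\<Theta>. \<Theta> \<in> ?F \<epsilon>) \<Theta>" if "0 < \<epsilon>" for \<epsilon>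
    using ne sip_feasible_subset_relaxed[OF tup[OF that]]
    by (intro ex1_arg_min_strictly_convex compact_convex_relaxed_feasible tup that
        continuous_on_reg_cost strictly_convex_reg_cost) auto
  have "is_arg_min (\<lambda>\<Theta>. costJ S \<Theta> + \<epsilon> * reg S \<Theta>) (\<lambda>\<Theta>. \<Theta> \<in> ?K) (?m \<epsilon>)" if "0 < \<epsilon>" for \<epsilon>
  proof -
    obtain \<Theta>s where \<Theta>s: "is_arg_min (reg_cost S \<epsilon>) (\<lambda>\<Theta>. \<Theta> \<in> ?K) \<Theta>s"
      using min[OF \<open>0 < \<epsilon>\<close>] by blast
    have "?m \<epsilon> = \<Theta>s"
      by (intro the1_equality ex1 that maximal_relaxation_exact(2)[OF that ne max[OF that] \<Theta>s])
    then show ?thesis using \<Theta>s unfolding reg_cost_def by simp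
  qed
  from tendsto_regularized_minimizers[OF compact_convex_sip_feasible ne continuous_on_costJ convex_costJ
      continuous_on_subset[OF reg_cont subset_UNIV] reg_strict reg_pos this]
  show ?thesis using V ex1 by blast
qed

end
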